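(* Let $R_2$ be the equivalence relation on $[0,1]$ given by $(x,y)\in R_2$ iff there exists $f\in F$ with $f(x)=y$, where $F$ is the Thompson group. Let $\Phi=\{\varphi_1,\varphi_2,\varphi_3\}$ where $\varphi_1:[0,1/2]\to[0,3/4]$, $\varphi_1(x)=A^{-1}(x)$; $\varphi_2:[1/2,3/4]\to[1/2,7/8]$, $\varphi_2(x)=B^{-1}(x)$; $\varphi_3:[3/4,1]\to[1/2,1]$, $\varphi_3(x)=A(x)$. Then $R_2=R_\Phi$, the equivalence relation generated by $\Phi$.
   Context: The Thompson group $F$ is the group of piecewise linear homeomorphisms of $[0,1]$ that are differentiable except at finitely many points, all dyadic rationals, and whose derivatives on intervals of differentiability are (integer) powers of $2$. It is a known fact that $F$ is generated by $$A(x)=\begin{cases} x/2, & 0\le x\le 1/2\\ x-1/4, & 1/2\le x\le 3/4\\ 2x-1, & 3/4\le x\le 1\end{cases}\qquad B(x)=\begin{cases} x, & 0\le x\le 1/2\\ x/2+1/4, & 1/2\le x\le 3/4\\ x-1/8, & 3/4\le x\le 7/8\\ 2x-1, & 7/8\le x\le 1.\end{cases}$$ For a countable family $\Phi=(\varphi_i:A_i\to B_i)_{i\in I}$ of Borel partial isomorphisms between Borel subsets of $[0,1]$ (not required to preserve Lebesgue measure), $R_\Phi$ is the smallest equivalence relation on $[0,1]$ containing all pairs $(x,\varphi_i(x))$ with $x\in A_i$, $i\in I$. *)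

theory Defs
  imports "HOL-Analysis.Analysis"
begin

definition dyadic_rationals :: "real set" where
  "dyadic_rationals = {x. \<exists>(a::int) (n::nat). x = of_int a / 2 ^ n}"

definition piecewise_linear_on :: "real \<Rightarrow> real \<Rightarrow> (real \<Rightarrow> real) \<Rightarrow> bool" where
  "piecewise_linear_on a b f \<longleftrightarrow>
     (\<exists>(n::nat) t. t 0 = a \<and> t n = b \<and> (\<forall>i<n. t i < t (Suc i)) \<and>
        (\<forall>i<n. \<exists>m c. \<forall>x\<in>{t i..t (Suc i)}. f x = m * x + c))"

text \<open>Self-maps of the unit interval are represented by functions on the reals that are
  \<^const>\<open>undefined\<close> outside the interval; accordingly, differentiability is relative to the interval
  (one-sided at the endpoints, which are dyadic anyway).\<close>

definition thompson_F :: "(real \<Rightarrow> real) set" where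
  "thompson_F = {f \<in> extensional {0..1}.
     (\<exists>g. homeomorphism {0..1} {0..1} f g) \<and>
     piecewise_linear_on 0 1 f \<and>
     finite {x\<in>{0..1}. \<not> f differentiable (at x within {0..1})} \<and>
     {x\<in>{0..1}. \<not> f differentiable (at x within {0..1})} \<subseteq> dyadic_rationals \<and>
     (\<forall>x\<in>{0..1}. f differentiable (at x within {0..1}) \<longrightarrow>
        (\<exists>k::int. (f has_real_derivative 2 powi k) (at x within {0..1})))}"

definition thompson_A :: "real \<Rightarrow> real" where
  "thompson_A = (\<lambda>x\<in>{0..1}.
     if x \<le> 1/2 then x / 2
     else if x \<le> 3/4 then x - 1/4
     else 2 * x - 1)"

definition thompson_B :: "real \<Rightarrow> real" where
  "thompson_B = (\<lambda>x\<in>{0..1}.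
     if x \<le> 1/2 then x
     else if x \<le> 3/4 then x / 2 + 1/4
     else if x \<le> 7/8 then x - 1/8
     else 2 * x - 1)"

definition thompson_orbit_rel :: "(real \<times> real) set" where
  "thompson_orbit_rel = {(x, y). x \<in> {0..1} \<and> y \<in> {0..1} \<and> (\<exists>f\<in>thompson_F. f x = y)}"

text \<open>A partial map is a triple of domain, codomain and underlying function, of which only the
  values on the domain are relevant.\<close>

type_synonym partial_map = "real set \<times> real set \<times> (real \<Rightarrow> real)"

definition borel_partial_iso :: "partial_map \<Rightarrow> bool" where
  "borel_partial_iso = (\<lambda>(S, T, \<phi>).
     S \<subseteq> {0..1} \<and> T \<subseteq> {0..1} \<and> S \<in> sets borel \<and> T \<in> sets borel \<and> bij_betw \<phi> S T \<and>
     \<phi> \<in> borel_measurable (restrict_space borel S) \<and>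
     inv_into S \<phi> \<in> borel_measurable (restrict_space borel T))"

definition generated_equiv_rel :: "partial_map set \<Rightarrow> (real \<times> real) set" where
  "generated_equiv_rel \<Phi> =
     \<Inter> {R. equiv {0..1} R \<and> (\<forall>(S, T, \<phi>)\<in>\<Phi>. \<forall>x\<in>S. (x, \<phi> x) \<in> R)}"

lemma generated_equiv_rel_equiv:
  assumes "\<And>p. p \<in> \<Phi> \<Longrightarrow> borel_partial_iso p"
  shows "equiv {0..1} (generated_equiv_rel \<Phi>)"
proof -
  let ?U = "{0..1::real} \<times> {0..1}"
  let ?C = "{R. equiv {0..1} R \<and> (\<forall>(S, T, \<phi>)\<in>\<Phi>. \<forall>x\<in>S. (x, \<phi> x) \<in> R)}"
  have "(x, \<phi> x) \<in> ?U" if "(S, T, \<phi>) \<in> \<Phi>" "x \<in> S" for S T \<phi> x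
    using assms[OF that(1)] that(2) unfolding borel_partial_iso_def
    by (auto simp: bij_betw_def)
  moreover have "equiv {0..1} ?U"
    by (auto simp: equiv_def refl_on_def sym_def trans_def)
  ultimately have U: "?U \<in> ?C"
    by auto
  show ?thesis
    unfolding generated_equiv_rel_def
  proof (rule equivI)
    show "\<Inter> ?C \<subseteq> ?U" using U by (rule Inter_lower)
    show "refl_on {0..1} (\<Inter> ?C)" by (auto simp: refl_on_def equiv_def)
    show "sym (\<Inter> ?C)" unfolding sym_def equiv_def by blast
    show "trans (\<Inter> ?C)" unfolding trans_def equiv_def by blast
  qed
qed

lemma thompson_A_inj: "inj_on thompson_A {0..1}"
  by (auto simp: inj_on_def thompson_A_def split: if_splits)

lemma thompson_B_inj: "inj_on thompson_B {0..1}"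
  by (auto simp: inj_on_def thompson_B_def split: if_splits)

lemma inv_thompson_A:
  assumes "y \<in> {0..1}"
  shows "inv_into {0..1} thompson_A y =
    (if y \<le> 1/4 then 2 * y else if y \<le> 1/2 then y + 1/4 else (y + 1) / 2)"
  by (rule inv_into_f_eq[OF thompson_A_inj])
     (use assms in \<open>auto simp: thompson_A_def field_simps\<close>)

lemma inv_thompson_B:
  assumes "y \<in> {0..1}"
  shows "inv_into {0..1} thompson_B y =
    (if y \<le> 1/2 then y else if y \<le> 5/8 then 2 * y - 1/2
     else if y \<le> 3/4 then y + 1/8 else (y + 1) / 2)"
  by (rule inv_into_f_eq[OF thompson_B_inj])
     (use assms in \<open>auto simp: thompson_B_def field_simps\<close>)

lemma borel_partial_isoI:
  assumes "S \<subseteq> {0..1}" "T \<subseteq> {0..1}" "S \<in> sets borel" "T \<in> sets borel"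
    and "\<And>x. x \<in> S \<Longrightarrow> \<phi> x = f x" "f \<in> borel_measurable borel" "g \<in> borel_measurable borel"
    and "\<And>x. x \<in> S \<Longrightarrow> f x \<in> T \<and> g (f x) = x" "\<And>y. y \<in> T \<Longrightarrow> g y \<in> S \<and> f (g y) = y"
  shows "borel_partial_iso (S, T, \<phi>)"
proof -
  have bij: "bij_betw \<phi> S T"
    by (rule bij_betw_byWitness[where f' = g]) (use assms(5,8,9) in auto)
  have inv: "inv_into S \<phi> y = g y" if "y \<in> T" for y
    by (rule inv_into_f_eq) (use bij that assms(5,9) in \<open>auto simp: bij_betw_def\<close>)
  have "\<phi> \<in> borel_measurable (restrict_space borel S)"
    using measurable_restrict_space1[OF assms(6)] assms(5)
    by (subst measurable_cong[where g = f]) (auto simp: space_restrict_space)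
  moreover have "inv_into S \<phi> \<in> borel_measurable (restrict_space borel T)"
    using measurable_restrict_space1[OF assms(7)] inv
    by (subst measurable_cong[where g = g]) (auto simp: space_restrict_space)
  ultimately show ?thesis
    using assms(1-4) bij by (simp add: borel_partial_iso_def)
qed

lemma borel_partial_iso_1: "borel_partial_iso ({0..1/2}, {0..3/4}, inv_into {0..1} thompson_A)"
  by (rule borel_partial_isoI[where f = "\<lambda>y. if y \<le> 1/4 then 2 * y else y + 1/4"
        and g = "\<lambda>x. if x \<le> 1/2 then x / 2 else x - 1/4"])
     (auto simp: inv_thompson_A)

lemma borel_partial_iso_2: "borel_partial_iso ({1/2..3/4}, {1/2..7/8}, inv_into {0..1} thompson_B)"
  by (rule borel_partial_isoI[where f = "\<lambda>y. if y \<le> 5/8 then 2 * y - 1/2 else y + 1/8"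
        and g = "\<lambda>x. if x \<le> 3/4 then x / 2 + 1/4 else x - 1/8"])
     (auto simp: inv_thompson_B field_simps)

lemma borel_partial_iso_3: "borel_partial_iso ({3/4..1}, {1/2..1}, thompson_A)"
  by (rule borel_partial_isoI[where f = "\<lambda>x. 2 * x - 1" and g = "\<lambda>y. (y + 1) / 2"])
     (auto simp: thompson_A_def field_simps)

lemma thompson_FI:
  fixes t :: "nat \<Rightarrow> real"
  assumes ext: "f \<in> extensional {0..1}" and hom: "homeomorphism {0..1} {0..1} f g"
    and t: "t 0 = 0" "t n = 1" "\<And>i. i < n \<Longrightarrow> t i < t (Suc i)"
    and dy: "\<And>i. i \<le> n \<Longrightarrow> t i \<in> dyadic_rationals"
    and aff: "\<And>i. i < n \<Longrightarrow> \<exists>(k::int) c. \<forall>x\<in>{t i..t (Suc i)}. f x = 2 powi k * x + c"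
  shows "f \<in> thompson_F"
proof -
  let ?N = "{x\<in>{0..1}. \<not> f differentiable (at x within {0..1})}"
  have mono: "t i \<le> t j" if "i \<le> j" "j \<le> n" for i j
    using that
  proof (induction j)
    case (Suc j)
    then show ?case using t(3)[of j] by (cases "i = Suc j") auto
  qed simp
  have piece: "\<exists>i<n. x \<in> {t i..t (Suc i)}" if x: "x \<in> {0..1}" for x
  proof -
    define j where "j = (LEAST j. x \<le> t j)"
    have ex: "x \<le> t n" using x t by auto
    have j: "x \<le> t j" unfolding j_def using ex by (rule LeastI)
    have jn: "j \<le> n" unfolding j_def using ex by (rule Least_le)
    show ?thesis
    proof (cases j)
      case 0
      have "n \<noteq> 0" using t(1,2) by (metis zero_neq_one)
      moreover have "x = t 0" using 0 j x t(1) by auto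
      ultimately show ?thesis using t(3)[of 0] by (intro exI[of _ 0]) auto
    next
      case (Suc i)
      then have "\<not> x \<le> t i" using not_less_Least[of i "\<lambda>j. x \<le> t j"] by (simp add: j_def)
      then show ?thesis using Suc j jn by (intro exI[of _ i]) auto
    qed
  qed
  have loc: "\<exists>k::int. (f has_real_derivative 2 powi k) (at x within {t i..t (Suc i)})"
    if i: "i < n" and x: "x \<in> {t i..t (Suc i)}" for x i
  proof -
    obtain k c where kc: "\<forall>x\<in>{t i..t (Suc i)}. f x = 2 powi (k::int) * x + c"
      using aff[OF i] by blast
    have "((\<lambda>x. 2 powi k * x + c) has_real_derivative 2 powi k) (at x within {t i..t (Suc i)})"
      by (auto intro!: derivative_eq_intros)
    then have "(f has_real_derivative 2 powi k) (at x within {t i..t (Suc i)})"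
      by (rule has_field_derivative_transform_within[where d = 1]) (use kc x in auto)
    then show ?thesis ..
  qed
  have N: "?N \<subseteq> t ` {..n}"
  proof
    fix x assume "x \<in> ?N"
    then have x: "x \<in> {0..1}" and nd: "\<not> f differentiable (at x within {0..1})" by auto
    obtain i where i: "i < n" "x \<in> {t i..t (Suc i)}" using piece[OF x] by blast
    show "x \<in> t ` {..n}"
    proof (rule ccontr)
      assume "x \<notin> t ` {..n}"
      then have "x \<noteq> t i" "x \<noteq> t (Suc i)" using i(1) by auto
      then have "at x within {t i..t (Suc i)} = at x"
        using i(2) by (intro at_within_Icc_at) auto
      with loc[OF i] obtain k :: int where "(f has_real_derivative 2 powi k) (at x)" by auto
      then have "(f has_real_derivative 2 powi k) (at x within {0..1})"
        by (rule has_field_derivative_at_within)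
      with nd show False
        using real_differentiable_def by blast
    qed
  qed
  have der: "\<exists>k::int. (f has_real_derivative 2 powi k) (at x within {0..1})"
    if x: "x \<in> {0..1}" and d: "f differentiable (at x within {0..1})" for x
  proof -
    obtain D where D: "(f has_real_derivative D) (at x within {0..1})"
      using d real_differentiable_def by blast
    obtain i where i: "i < n" "x \<in> {t i..t (Suc i)}" using piece[OF x] by blast
    obtain k :: int where k: "(f has_real_derivative 2 powi k) (at x within {t i..t (Suc i)})"
      using loc[OF i] by blast
    have "{t i..t (Suc i)} \<subseteq> {0..1}"
      using mono[of 0 i] mono[of "Suc i" n] i(1) t(1,2) by auto
    with D have "(f has_real_derivative D) (at x within {t i..t (Suc i)})"
      by (rule has_field_derivative_subset)
    moreover have "at x within {t i..t (Suc i)} \<noteq> bot"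
      using t(3)[OF i(1)] i(2) by (simp add: trivial_limit_within islimpt_Icc)
    ultimately have "D = 2 powi k"
      using k has_field_derivative_unique by blast
    with D show ?thesis by blast
  qed
  have "piecewise_linear_on 0 1 f"
    unfolding piecewise_linear_on_def using t aff by blast
  moreover have "finite ?N" using N by (rule finite_subset) simp
  moreover have "?N \<subseteq> dyadic_rationals" using N dy by auto
  ultimately show ?thesis
    unfolding thompson_F_def using ext hom der by blast
qed

lemma thompson_A_in_F: "thompson_A \<in> thompson_F"
proof -
  have "continuous_on {0..1} (\<lambda>x::real. max (max (x / 2) (x - 1/4)) (2 * x - 1))"
    by (intro continuous_intros) auto
  then have cont: "continuous_on {0..1} thompson_A"
    by (rule iffD1[OF continuous_on_cong, rotated 2]) (auto simp: thompson_A_def max_def)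
  have "y \<in> thompson_A ` {0..1}" if "y \<in> {0..1}" for y
    by (rule image_eqI[of _ _ "if y \<le> 1/4 then 2 * y else if y \<le> 1/2 then y + 1/4 else (y + 1) / 2"])
       (use that in \<open>auto simp: thompson_A_def field_simps\<close>)
  moreover have "thompson_A x \<in> {0..1}" if "x \<in> {0..1}" for x
    using that by (auto simp: thompson_A_def)
  ultimately have "thompson_A ` {0..1} = {0..1}"
    by blast
  then obtain g where g: "homeomorphism {0..1} {0..1} thompson_A g"
    using homeomorphism_compact[OF compact_Icc cont _ thompson_A_inj] by blast
  define t where "t = (!) [0, 1/2, 3/4, 1 :: real]"
  show ?thesis
  proof (rule thompson_FI[OF _ g, of t 3])
    fix i :: nat
    show "t i < t (Suc i)" if "i < 3"
      using that by (auto simp: t_def less_Suc_eq numeral_eq_Suc)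
    have "\<exists>(a::int) n. t i = of_int a / 2 ^ n" if "i \<le> 3"
      using that by (intro exI[of _ "\<lfloor>4 * t i\<rfloor>"] exI[of _ "2"]) (auto simp: t_def le_Suc_eq numeral_3_eq_3)
    then show "t i \<in> dyadic_rationals" if "i \<le> 3"
      using that by (simp add: dyadic_rationals_def)
    assume "i < 3"
    then consider "i = 0" | "i = 1" | "i = 2" by linarith
    then show "\<exists>(k::int) c. \<forall>x\<in>{t i..t (Suc i)}. thompson_A x = 2 powi k * x + c"
    proof cases
      case 1
      show ?thesis
        by (intro exI[of _ "-1"] exI[of _ "0"]) (auto simp: 1 t_def thompson_A_def power_int_minus)
    next
      case 2
      show ?thesis
        by (intro exI[of _ "0"] exI[of _ "-1/4"]) (auto simp: 2 t_def thompson_A_def)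
    next
      case 3
      show ?thesis
        by (intro exI[of _ "1"] exI[of _ "-1"]) (auto simp: 3 t_def thompson_A_def)
    qed
  qed (auto simp: t_def thompson_A_def)
qed

lemma thompson_B_in_F: "thompson_B \<in> thompson_F"
proof -
  have "continuous_on {0..1} (\<lambda>x::real. min x (max (max (x / 2 + 1/4) (x - 1/8)) (2 * x - 1)))"
    by (intro continuous_intros) auto
  then have cont: "continuous_on {0..1} thompson_B"
    by (rule iffD1[OF continuous_on_cong, rotated 2]) (auto simp: thompson_B_def max_def min_def)
  have "y \<in> thompson_B ` {0..1}" if "y \<in> {0..1}" for y
    by (rule image_eqI[of _ _ "if y \<le> 1/2 then y else if y \<le> 5/8 then 2 * y - 1/2
          else if y \<le> 3/4 then y + 1/8 else (y + 1) / 2"])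
       (use that in \<open>auto simp: thompson_B_def field_simps\<close>)
  moreover have "thompson_B x \<in> {0..1}" if "x \<in> {0..1}" for x
    using that by (auto simp: thompson_B_def)
  ultimately have "thompson_B ` {0..1} = {0..1}"
    by blast
  then obtain g where g: "homeomorphism {0..1} {0..1} thompson_B g"
    using homeomorphism_compact[OF compact_Icc cont _ thompson_B_inj] by blast
  define t where "t = (!) [0, 1/2, 3/4, 7/8, 1 :: real]"
  show ?thesis
  proof (rule thompson_FI[OF _ g, of t 4])
    fix i :: nat
    show "t i < t (Suc i)" if "i < 4"
      using that by (auto simp: t_def less_Suc_eq numeral_eq_Suc)
    have "\<exists>(a::int) n. t i = of_int a / 2 ^ n" if "i \<le> 4"
      using that by (intro exI[of _ "\<lfloor>8 * t i\<rfloor>"] exI[of _ "3"]) (auto simp: t_def le_Suc_eq eval_nat_numeral(2,3))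
    then show "t i \<in> dyadic_rationals" if "i \<le> 4"
      using that by (simp add: dyadic_rationals_def)
    assume "i < 4"
    then consider "i = 0" | "i = 1" | "i = 2" | "i = 3" by linarith
    then show "\<exists>(k::int) c. \<forall>x\<in>{t i..t (Suc i)}. thompson_B x = 2 powi k * x + c"
    proof cases
      case 1
      show ?thesis
        by (intro exI[of _ "0"] exI[of _ "0"]) (auto simp: 1 t_def thompson_B_def)
    next
      case 2
      show ?thesis
        by (intro exI[of _ "-1"] exI[of _ "1/4"]) (auto simp: 2 t_def thompson_B_def power_int_minus)
    next
      case 3
      show ?thesis
        by (intro exI[of _ "0"] exI[of _ "-1/8"]) (auto simp: 3 t_def thompson_B_def)
    next
      case 4
      show ?thesis
        by (intro exI[of _ "1"] exI[of _ "-1"]) (auto simp: 4 t_def thompson_B_def)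
    qed
  qed (auto simp: t_def thompson_B_def)
qed

end

theory Submission
  imports Defs
begin

text \<open>Call \<open>x\<close> and \<open>y\<close> dyadically equivalent if \<open>y = 2\<^sup>k x + d\<close> with \<open>k\<close> an integer and \<open>d\<close> a dyadic
  rational. An element of \<open>F\<close> fixes \<open>0\<close> and \<open>1\<close> and moves every other point to a dyadically equivalent
  one, because its pieces have slopes that are powers of two and, starting from \<open>f 0 = 0\<close>, dyadic
  intercepts. Conversely, any equivalence relation containing the three partial maps identifies all
  dyadically equivalent points of the open interval: on binary expansions the maps move each point
  to one of the form \<open>10w\<close>, and then allow the first digit of \<open>w\<close> to be erased; dyadically equivalent
  points acquire a common tail after erasing enough digits. The other inclusion holds since \<open>F\<close> is a
  group containing \<open>A\<close> and \<open>B\<close>.\<close>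

section \<open>Dyadic affine equivalence\<close>

lemma dyadic_rationals_of_int [simp]: "of_int a \<in> dyadic_rationals"
  unfolding dyadic_rationals_def by (auto intro!: exI[of _ a] exI[of _ "0::nat"])

lemma dyadic_rationals_0 [simp]: "0 \<in> dyadic_rationals"
  and dyadic_rationals_1 [simp]: "1 \<in> dyadic_rationals"
  using dyadic_rationals_of_int[of 0] dyadic_rationals_of_int[of 1] by simp_all

lemma dyadic_rationals_divide_power: "of_int a / 2 ^ n \<in> dyadic_rationals"
  unfolding dyadic_rationals_def by blast

lemma dyadic_rationals_add:
  assumes "x \<in> dyadic_rationals" "y \<in> dyadic_rationals"
  shows "x + y \<in> dyadic_rationals"
proof -
  obtain a b :: int and m n :: nat where "x = of_int a / 2 ^ m" "y = of_int b / 2 ^ n"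
    using assms unfolding dyadic_rationals_def by blast
  then have "x + y = of_int (a * 2 ^ n + b * 2 ^ m) / 2 ^ (m + n)"
    by (simp add: add_divide_distrib power_add)
  then show ?thesis by (metis dyadic_rationals_divide_power)
qed

lemma dyadic_rationals_mult:
  assumes "x \<in> dyadic_rationals" "y \<in> dyadic_rationals"
  shows "x * y \<in> dyadic_rationals"
proof -
  obtain a b :: int and m n :: nat where "x = of_int a / 2 ^ m" "y = of_int b / 2 ^ n"
    using assms unfolding dyadic_rationals_def by blast
  then have "x * y = of_int (a * b) / 2 ^ (m + n)"
    by (simp add: power_add)
  then show ?thesis by (metis dyadic_rationals_divide_power)
qed

lemma dyadic_rationals_minus: "x \<in> dyadic_rationals \<Longrightarrow> - x \<in> dyadic_rationals"
  using dyadic_rationals_mult[of "of_int (-1)" x] by (simp del: of_int_minus) simp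

lemma dyadic_rationals_diff:
  "x \<in> dyadic_rationals \<Longrightarrow> y \<in> dyadic_rationals \<Longrightarrow> x - y \<in> dyadic_rationals"
  using dyadic_rationals_add[of x "- y"] dyadic_rationals_minus by simp

lemma dyadic_rationals_powi [simp]: "2 powi (k::int) \<in> dyadic_rationals"
proof (cases "k \<ge> 0")
  case True
  then have "2 powi k = (of_int (2 ^ nat k) :: real)" by (simp add: power_int_def)
  then show ?thesis by (metis dyadic_rationals_of_int)
next
  case False
  then have "2 powi k = (of_int 1 / 2 ^ nat (-k) :: real)"
    by (simp add: power_int_def field_simps)
  then show ?thesis by (metis dyadic_rationals_divide_power)
qed

text \<open>This is the orbit relation on the line of the group of affine maps x -> 2^k x + d with d
  dyadic. The intercept appears only as a difference, so a single quantifier over k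
  suffices.\<close>

definition dyadic_equiv :: "real \<Rightarrow> real \<Rightarrow> bool" where
  "dyadic_equiv x y \<longleftrightarrow> (\<exists>k::int. y - 2 powi k * x \<in> dyadic_rationals)"

lemma dyadic_equivI:
  "y = 2 powi k * x + c \<Longrightarrow> c \<in> dyadic_rationals \<Longrightarrow> dyadic_equiv x y"
  unfolding dyadic_equiv_def by (intro exI[of _ k]) simp

lemma dyadic_equiv_refl [simp]: "dyadic_equiv x x"
  by (rule dyadic_equivI[of _ 0 _ 0]) auto

lemma dyadic_equiv_sym:
  assumes "dyadic_equiv x y"
  shows "dyadic_equiv y x"
proof -
  obtain k :: int where k: "y - 2 powi k * x \<in> dyadic_rationals"
    using assms unfolding dyadic_equiv_def by blast
  have "x = 2 powi (-k) * y + - (2 powi (-k) * (y - 2 powi k * x))"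
    by (simp add: power_int_minus field_simps)
  then show ?thesis
    by (rule dyadic_equivI) (intro dyadic_rationals_minus dyadic_rationals_mult k dyadic_rationals_powi)
qed

lemma dyadic_equiv_trans:
  assumes "dyadic_equiv x y" "dyadic_equiv y z"
  shows "dyadic_equiv x z"
proof -
  obtain k :: int where k: "y - 2 powi k * x \<in> dyadic_rationals"
    using assms unfolding dyadic_equiv_def by blast
  obtain l :: int where l: "z - 2 powi l * y \<in> dyadic_rationals"
    using assms unfolding dyadic_equiv_def by blast
  have "z = 2 powi (l + k) * x + ((z - 2 powi l * y) + 2 powi l * (y - 2 powi k * x))"
    by (simp add: power_int_add algebra_simps)
  then show ?thesis
    by (rule dyadic_equivI) (intro dyadic_rationals_add dyadic_rationals_mult k l dyadic_rationals_powi)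
qed

text \<open>The dyadic rationals form a ring containing every 2^k, so these affine maps preserve it.
  The lemma keeps breakpoints dyadic under images and preimages by elements of F.\<close>

lemma dyadic_equiv_dyadic:
  assumes "dyadic_equiv x y" "x \<in> dyadic_rationals"
  shows "y \<in> dyadic_rationals"
proof -
  obtain k :: int where k: "y - 2 powi k * x \<in> dyadic_rationals"
    using assms unfolding dyadic_equiv_def by blast
  have "(y - 2 powi k * x) + 2 powi k * x \<in> dyadic_rationals"
    by (intro dyadic_rationals_add dyadic_rationals_mult k assms dyadic_rationals_powi)
  then show ?thesis by simp
qed

section \<open>The relation generated by the three partial maps\<close>

text \<open>Here \<open>R\<close> is an arbitrary member of the family whose intersection is
  \<open>generated_equiv_rel\<close>. Working inside every such \<open>R\<close> replaces an
  explicit description of the generated relation by chains of generators.\<close>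

context
  fixes R :: "(real \<times> real) set"
  assumes equiv: "equiv {0..1} R"
    and gen1: "\<forall>x\<in>{0..1/2}. (x, inv_into {0..1} thompson_A x) \<in> R"
    and gen2: "\<forall>x\<in>{1/2..3/4}. (x, inv_into {0..1} thompson_B x) \<in> R"
    and gen3: "\<forall>x\<in>{3/4..1}. (x, thompson_A x) \<in> R"
begin

section \<open>The generators as moves on binary expansions\<close>

lemma R_sym: "(x, y) \<in> R \<Longrightarrow> (y, x) \<in> R"
  using equiv unfolding equiv_def sym_def by blast

lemma R_trans: "(x, y) \<in> R \<Longrightarrow> (y, z) \<in> R \<Longrightarrow> (x, z) \<in> R"
  using equiv unfolding equiv_def trans_def by blast

lemma R_refl: "x \<in> {0..1} \<Longrightarrow> (x, x) \<in> R"
  using equiv unfolding equiv_def refl_on_def by blast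

text \<open>In binary, \<open>00w\<close> is related to \<open>0w\<close>; the next two rules relate
  \<open>01w\<close> to \<open>10w\<close> and \<open>11w\<close> to \<open>1w\<close>.\<close>

lemma R_double_left: "x \<in> {0..1/4} \<Longrightarrow> (x, 2 * x) \<in> R"
  using bspec[OF gen1, of x] by (simp add: inv_thompson_A)

lemma R_shift_left:
  assumes "x \<in> {1/4..1/2}"
  shows "(x, x + 1/4) \<in> R"
proof -
  \<comment> \<open>At the shared endpoint 1/4 the branches \<open>2 * x\<close> and
    \<open>x + 1/4\<close> agree.\<close>
  have "inv_into {0..1} thompson_A x = x + 1/4"
    using assms by (subst inv_thompson_A) auto
  with bspec[OF gen1, of x] assms show ?thesis by auto
qed

lemma R_double_right:
  assumes "x \<in> {3/4..1}"
  shows "(x, 2 * x - 1) \<in> R"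
proof -
  have "thompson_A x = 2 * x - 1"
    using assms by (auto simp: thompson_A_def)
  with bspec[OF gen3, of x] assms show ?thesis by auto
qed

text \<open>In binary, \<open>1/2 + s/4\<close> is the expansion of \<open>s\<close> preceded by \<open>10\<close>. The generators give
  \<open>100w \<sim> 10w\<close> and \<open>101w \<sim> 110w \<sim> 10w\<close>, so the digit after the prefix can be erased.\<close>

lemma R_erase_0:
  assumes "s \<in> {0..1/2}"
  shows "(1/2 + s/4, 1/2 + (2 * s)/4) \<in> R"
  using bspec[OF gen2, of "1/2 + s/4"] assms by (auto simp: inv_thompson_B split: if_splits)

lemma R_erase_1:
  assumes "s \<in> {1/2..1}"
  shows "(1/2 + s/4, 1/2 + (2 * s - 1)/4) \<in> R"
proof -
  have "inv_into {0..1} thompson_B (1/2 + s/4) = 5/8 + s/4"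
    using assms by (subst inv_thompson_B) auto
  with bspec[OF gen2, of "1/2 + s/4"] assms have "(1/2 + s/4, 5/8 + s/4) \<in> R"
    by auto
  moreover have "(5/8 + s/4, 1/2 + (2 * s - 1)/4) \<in> R"
    using R_double_right[of "5/8 + s/4"] assms by (simp add: diff_divide_distrib)
  ultimately show ?thesis by (rule R_trans)
qed

text \<open>Erasing n digits of \<open>s\<close> one at a time leaves \<open>2 ^ n * s\<close> minus
  an integer. The remainder may be 0 or 1, so at dyadic points \<open>j\<close> is not unique; the
  case n = 0 must therefore already identify the remainders 0 and 1.\<close>

lemma R_erase:
  assumes "s \<in> {0..1}" "2 ^ n * s - of_int j \<in> {0..1}"
  shows "(1/2 + s/4, 1/2 + (2 ^ n * s - of_int j)/4) \<in> R"
  using assms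
proof (induction n arbitrary: s j)
  case 0
  \<comment> \<open>The point s = 1/2 has expansions starting with 0 and with 1; erasing that digit
    leaves 1 or 0 respectively, so both remainders are related to the same point.\<close>
  have one_zero: "(1/2 + 1/4, 1/2 + 0/4) \<in> R"
    using R_trans[OF R_sym[OF R_erase_0[of "1/2"]] R_erase_1[of "1/2"]] by simp
  have "-1 \<le> (of_int j :: real)" "(of_int j :: real) \<le> 1"
    using 0 by auto
  then have "-1 \<le> j" "j \<le> 1" by linarith+
  then consider "j = 0" | "j = -1" | "j = 1" by linarith
  then show ?case
  proof cases
    case 1
    then show ?thesis using 0 R_refl[of "1/2 + s/4"] by auto
  next
    case 2
    then have "s = 0" using 0 by auto
    with 2 show ?thesis using R_sym[OF one_zero] by simp
  next
    case 3
    then have "s = 1" using 0 by auto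
    with 3 show ?thesis using one_zero by simp
  qed
next
  case (Suc n)
  show ?case
  proof (cases "s \<le> 1/2")
    case True
    have "(1/2 + (2 * s)/4, 1/2 + (2 ^ n * (2 * s) - of_int j)/4) \<in> R"
      by (rule Suc.IH) (use True Suc.prems in \<open>auto simp: mult_ac\<close>)
    then have *: "(1/2 + (2 * s)/4, 1/2 + (2 ^ Suc n * s - of_int j)/4) \<in> R"
      by (simp add: mult_ac)
    show ?thesis
      by (rule R_trans[OF R_erase_0 *]) (use True Suc.prems(1) in auto)
  next
    case False
    \<comment> \<open>The erased digit 1 has weight \<open>2 ^ n\<close> after n further doublings,
      so \<open>j\<close> is lowered by that amount.\<close>
    have eq: "2 ^ n * (2 * s - 1) - of_int (j - 2 ^ n) = 2 ^ Suc n * s - of_int j"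
      by (simp add: algebra_simps)
    have "(1/2 + (2 * s - 1)/4, 1/2 + (2 ^ n * (2 * s - 1) - of_int (j - 2 ^ n))/4) \<in> R"
    proof (rule Suc.IH)
      show "2 * s - 1 \<in> {0..1}" using False Suc.prems(1) by auto
      show "2 ^ n * (2 * s - 1) - of_int (j - 2 ^ n) \<in> {0..1}"
        unfolding eq by (rule Suc.prems(2))
    qed
    then have *: "(1/2 + (2 * s - 1)/4, 1/2 + (2 ^ Suc n * s - of_int j)/4) \<in> R"
      unfolding eq .
    show ?thesis
      by (rule R_trans[OF R_erase_1 *]) (use False Suc.prems(1) in auto)
  qed
qed

text \<open>Multiplying the equation by \<open>2 ^ m\<close> shows that \<open>2 ^ m * s'\<close>
  and \<open>2 ^ (m + k) * s\<close> differ by the integer \<open>a\<close>. Hence erasing m digits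
  of \<open>s'\<close> and m + k digits of \<open>s\<close> can leave the same remainder.\<close>

lemma R_cylinder:
  assumes s: "s \<in> {0..1}" and s': "s' \<in> {0..1}" and eq: "s' = 2 ^ k * s + of_int a / 2 ^ m"
  shows "(1/2 + s/4, 1/2 + s'/4) \<in> R"
proof -
  define j where "j = \<lfloor>2 ^ m * s'\<rfloor>"
  have j: "2 ^ m * s' - of_int j \<in> {0..1}"
    unfolding j_def by (simp, linarith)
  have same: "2 ^ (m + k) * s - of_int (j - a) = 2 ^ m * s' - of_int j"
    unfolding eq by (simp add: field_simps power_add)
  have "(1/2 + s'/4, 1/2 + (2 ^ m * s' - of_int j)/4) \<in> R"
    by (rule R_erase[OF s' j])
  moreover have "(1/2 + s/4, 1/2 + (2 ^ (m + k) * s - of_int (j - a))/4) \<in> R"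
    by (rule R_erase[OF s]) (use same j in metis)
  ultimately show ?thesis
    unfolding same by (blast intro: R_trans R_sym)
qed

text \<open>Only a nonnegative exponent counts digits to erase. For a negative one, inverting the
  affine map exchanges the roles of \<open>s\<close> and \<open>s'\<close>.\<close>

lemma R_cylinder_dyadic_equiv:
  assumes s: "s \<in> {0..1}" and s': "s' \<in> {0..1}" and "dyadic_equiv s s'"
  shows "(1/2 + s/4, 1/2 + s'/4) \<in> R"
proof -
  have *: "(1/2 + s/4, 1/2 + s'/4) \<in> R"
    if ss: "s \<in> {0..1}" "s' \<in> {0..1}" "0 \<le> k" and d: "s' - 2 powi k * s \<in> dyadic_rationals" for s s' and k :: int
  proof -
    obtain a :: int and m :: nat where "s' - 2 powi k * s = of_int a / 2 ^ m"
      using d unfolding dyadic_rationals_def by blast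
    then have "s' = 2 ^ nat k * s + of_int a / 2 ^ m"
      using ss by (simp add: power_int_def algebra_simps)
    with ss show ?thesis by (intro R_cylinder) auto
  qed
  obtain k :: int where k: "s' - 2 powi k * s \<in> dyadic_rationals"
    using assms(3) unfolding dyadic_equiv_def by blast
  show ?thesis
  proof (cases "0 \<le> k")
    case True
    with * s s' k show ?thesis by blast
  next
    case False
    have "s - 2 powi (-k) * s' = - (2 powi (-k) * (s' - 2 powi k * s))"
      by (simp add: power_int_minus field_simps)
    then have "s - 2 powi (-k) * s' \<in> dyadic_rationals"
      using dyadic_rationals_minus dyadic_rationals_mult dyadic_rationals_powi k by metis
    with *[OF s' s, of "-k"] False show ?thesis by (auto intro: R_sym)
  qed
qed

section \<open>Moving points of the open interval into the cylinder \<open>10\<close>\<close>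

lemma R_to_middle:
  assumes "x \<in> {1/4..3/4}"
  shows "\<exists>s\<in>{0..1}. dyadic_equiv x s \<and> (x, 1/2 + s/4) \<in> R"
proof (cases "x \<le> 1/2")
  case True
  \<comment> \<open>Here x reads \<open>01w\<close> and is shifted to \<open>10w\<close>, where
    \<open>w\<close> expands 4x - 1.\<close>
  have "dyadic_equiv x (4 * x - 1)"
    by (rule dyadic_equivI[of _ 2 _ "of_int (-1)"]) (simp, rule dyadic_rationals_of_int)
  moreover have "(x, 1/2 + (4 * x - 1)/4) \<in> R"
    using R_shift_left[of x] True assms by (simp add: field_simps)
  ultimately show ?thesis using True assms by (intro bexI[of _ "4 * x - 1"]) auto
next
  case False
  \<comment> \<open>Here x already reads \<open>10w\<close>, where \<open>w\<close> expands 4x -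
    2.\<close>
  have "dyadic_equiv x (4 * x - 2)"
    by (rule dyadic_equivI[of _ 2 _ "of_int (-2)"]) (simp, rule dyadic_rationals_of_int)
  moreover have "(x, 1/2 + (4 * x - 2)/4) \<in> R"
    using R_refl[of x] assms by (simp add: field_simps)
  ultimately show ?thesis using False assms by (intro bexI[of _ "4 * x - 2"]) auto
qed

text \<open>Doubling removes leading zeros until the point reaches 1/4, and n bounds the number of
  doublings. The case n = 0 is vacuous because 1 exceeds 3/4.\<close>

lemma R_to_middle_left:
  assumes "1 / 2 ^ n \<le> x" "x \<le> 3/4"
  shows "\<exists>s\<in>{0..1}. dyadic_equiv x s \<and> (x, 1/2 + s/4) \<in> R"
  using assms
proof (induction n arbitrary: x)
  case (Suc n)
  show ?case
  proof (cases "1/4 \<le> x")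
    case True
    then show ?thesis using Suc.prems by (intro R_to_middle) auto
  next
    case False
    have "0 < x" using Suc.prems(1) by (rule less_le_trans[rotated]) simp
    obtain s where "s \<in> {0..1}" "dyadic_equiv (2 * x) s" "(2 * x, 1/2 + s/4) \<in> R"
      using Suc.IH[of "2 * x"] Suc.prems False by (auto simp: field_simps)
    moreover have "dyadic_equiv x (2 * x)"
      by (rule dyadic_equivI[of _ 1 _ 0]) auto
    moreover have "(x, 2 * x) \<in> R"
      using R_double_left[of x] False \<open>0 < x\<close> by auto
    ultimately show ?thesis by (blast intro: R_trans dyadic_equiv_trans)
  qed
qed simp

text \<open>This is the mirror image: x -> 2x - 1 doubles the distance to 1, removing leading
  ones.\<close>

lemma R_to_middle_right:
  assumes "1 / 2 ^ n \<le> 1 - x" "1/4 \<le> x"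
  shows "\<exists>s\<in>{0..1}. dyadic_equiv x s \<and> (x, 1/2 + s/4) \<in> R"
  using assms
proof (induction n arbitrary: x)
  case (Suc n)
  show ?case
  proof (cases "x \<le> 3/4")
    case True
    then show ?thesis using Suc.prems by (intro R_to_middle) auto
  next
    case False
    have "0 < 1 - x" using Suc.prems(1) by (rule less_le_trans[rotated]) simp
    obtain s where "s \<in> {0..1}" "dyadic_equiv (2 * x - 1) s" "(2 * x - 1, 1/2 + s/4) \<in> R"
      using Suc.IH[of "2 * x - 1"] Suc.prems False by (auto simp: field_simps)
    moreover have "dyadic_equiv x (2 * x - 1)"
      by (rule dyadic_equivI[of _ 1 _ "of_int (-1)"]) (simp, rule dyadic_rationals_of_int)
    moreover have "(x, 2 * x - 1) \<in> R"
      using R_double_right[of x] False \<open>0 < 1 - x\<close> by auto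
    ultimately show ?thesis by (blast intro: R_trans dyadic_equiv_trans)
  qed
qed simp

text \<open>Every point satisfies \<open>x \<le> 3/4\<close> or \<open>1/4 \<le> x\<close>, so one
  of the two inductions applies. The endpoints are excluded because the doubling moves fix
  them.\<close>

lemma R_to_cylinder:
  assumes "x \<in> {0<..<1}"
  shows "\<exists>s\<in>{0..1}. dyadic_equiv x s \<and> (x, 1/2 + s/4) \<in> R"
proof -
  have pos: "0 < min x (1 - x)" using assms by auto
  obtain n where "(1/2) ^ n < min x (1 - x)"
    using real_arch_pow_inv[OF pos, of "1/2"] by auto
  then have "1 / 2 ^ n \<le> x" "1 / 2 ^ n \<le> 1 - x"
    by (auto simp: power_one_over)
  then show ?thesis
    using R_to_middle_left[of n x] R_to_middle_right[of n x] by linarith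
qed

lemma dyadic_equiv_imp_R:
  assumes x: "x \<in> {0<..<1}" and y: "y \<in> {0<..<1}" and "dyadic_equiv x y"
  shows "(x, y) \<in> R"
proof -
  obtain s where s: "s \<in> {0..1}" "dyadic_equiv x s" "(x, 1/2 + s/4) \<in> R"
    using R_to_cylinder[OF x] by blast
  obtain s' where s': "s' \<in> {0..1}" "dyadic_equiv y s'" "(y, 1/2 + s'/4) \<in> R"
    using R_to_cylinder[OF y] by blast
  have "dyadic_equiv s s'"
    using s(2) s'(2) assms(3) by (blast intro: dyadic_equiv_trans dyadic_equiv_sym)
  then have "(1/2 + s/4, 1/2 + s'/4) \<in> R"
    by (rule R_cylinder_dyadic_equiv[OF s(1) s'(1)])
  with s(3) s'(3) show ?thesis by (blast intro: R_trans R_sym)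
qed

end

section \<open>Breakpoint sets\<close>

text \<open>A finite set of permitted breakpoints replaces an indexed partition, so that composition
  and inversion only need unions, preimages and images of sets. \<open>S\<close> may exceed the set
  of actual breakpoints, and the intercepts are not assumed dyadic; that is derived later.\<close>

definition dyadic_pl :: "real set \<Rightarrow> (real \<Rightarrow> real) \<Rightarrow> bool" where
  "dyadic_pl S f \<longleftrightarrow> finite S \<and> S \<subseteq> dyadic_rationals \<and>
     (\<forall>a b. 0 \<le> a \<longrightarrow> a < b \<longrightarrow> b \<le> 1 \<longrightarrow> {a<..<b} \<inter> S = {} \<longrightarrow>
        (\<exists>(k::int) c. \<forall>x\<in>{a..b}. f x = 2 powi k * x + c))"

lemma dyadic_pl_affine:
  assumes "dyadic_pl S f" "0 \<le> a" "a < b" "b \<le> 1" "{a<..<b} \<inter> S = {}"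
  shows "\<exists>(k::int) c. \<forall>x\<in>{a..b}. f x = 2 powi k * x + c"
  using assms unfolding dyadic_pl_def by blast

lemma dyadic_pl_in_thompson_F:
  assumes ext: "f \<in> extensional {0..1}" and hom: "homeomorphism {0..1} {0..1} f g"
    and pl: "dyadic_pl S f"
  shows "f \<in> thompson_F"
proof -
  \<comment> \<open>Adjoining 0 and 1 makes the increasing enumeration of \<open>T\<close> a
    partition of the whole interval.\<close>
  define T where "T = (S \<inter> {0..1}) \<union> {0, 1}"
  have fin: "finite T" and T: "T \<subseteq> dyadic_rationals" "T \<subseteq> {0..1}" "0 \<in> T" "1 \<in> T"
    using pl unfolding T_def dyadic_pl_def by auto
  define xs where "xs = sorted_list_of_set T"
  have xs: "set xs = T" "sorted_wrt (<) xs"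
    using fin unfolding xs_def by auto
  have ne: "xs \<noteq> []" using xs T by auto
  define n where "n = length xs - 1"
  have len: "length xs = Suc n" using ne unfolding n_def by (cases xs) auto
  have less: "xs ! i < xs ! j" if "i < j" "j \<le> n" for i j
    using sorted_wrt_nth_less[OF xs(2), of i j] that len by auto
  have mem: "xs ! i \<in> T" if "i \<le> n" for i
    using that len xs(1) nth_mem[of i xs] by auto
  have le: "xs ! i \<le> xs ! j" if "i \<le> j" "j \<le> n" for i j
    using less[of i j] that by (cases "i = j") auto
  have ex: "\<exists>i\<le>n. xs ! i = t" if "t \<in> T" for t
    using that len xs(1) by (metis in_set_conv_nth less_Suc_eq_le)
  show ?thesis
  proof (rule thompson_FI[OF ext hom, of "(!) xs" n])
    show "xs ! 0 = 0"
      using ex[OF T(3)] le[of 0] mem[of 0] T(2) by force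
    show "xs ! n = 1"
      using ex[OF T(4)] le[of _ n] mem[of n] T(2) by force
    show "xs ! i \<in> dyadic_rationals" if "i \<le> n" for i
      using mem[OF that] T(1) by blast
    fix i assume i: "i < n"
    show "xs ! i < xs ! Suc i" using less[of i "Suc i"] i by auto
    have "{xs ! i<..<xs ! Suc i} \<inter> T = {}"
    proof (rule ccontr)
      assume "{xs ! i<..<xs ! Suc i} \<inter> T \<noteq> {}"
      then obtain t where t: "t \<in> T" "xs ! i < t" "t < xs ! Suc i" by auto
      then obtain j where j: "j \<le> n" "xs ! j = t" using ex by blast
      then show False using t le[of j i] le[of "Suc i" j] i by (cases "j \<le> i") auto
    qed
    moreover have "0 \<le> xs ! i" "xs ! Suc i \<le> 1"
      using mem[of i] mem[of "Suc i"] i T(2) by auto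
    ultimately have "{xs ! i<..<xs ! Suc i} \<inter> S = {}"
      unfolding T_def by auto
    then show "\<exists>(k::int) c. \<forall>x\<in>{xs ! i..xs ! Suc i}. f x = 2 powi k * x + c"
      by (rule dyadic_pl_affine[OF pl \<open>0 \<le> xs ! i\<close> \<open>xs ! i < xs ! Suc i\<close> \<open>xs ! Suc i \<le> 1\<close>])
  qed
qed

section \<open>Partitions without removable points\<close>

lemma partition_mono:
  fixes t :: "nat \<Rightarrow> real"
  assumes "\<And>i. i < n \<Longrightarrow> t i < t (Suc i)" "i \<le> j" "j \<le> n"
  shows "t i \<le> t j"
  using assms(2,3)
proof (induction j)
  case (Suc j)
  then show ?case using assms(1)[of j] by (cases "i = Suc j") auto
qed simp

lemma affine_has_derivative_within:
  fixes f :: "real \<Rightarrow> real"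
  assumes "\<And>x. x \<in> {a..b} \<Longrightarrow> f x = m * x + c" "x \<in> {a..b}"
  shows "(f has_real_derivative m) (at x within {a..b})"
proof -
  have "((\<lambda>x. m * x + c) has_real_derivative m) (at x within {a..b})"
    by (auto intro!: derivative_eq_intros)
  then show ?thesis
    by (rule has_field_derivative_transform_within[where d = 1]) (use assms in auto)
qed

text \<open>The point may be an end of the piece: it is still a limit point of it, so the derivative
  restricted to the piece is unique. At a breakpoint this ties the derivative to the slopes on both
  sides.\<close>

lemma derivative_within_affine:
  fixes f :: "real \<Rightarrow> real"
  assumes "(f has_real_derivative D) (at x within T)" "{a..b} \<subseteq> T" "a < b" "x \<in> {a..b}"
    and "\<And>x. x \<in> {a..b} \<Longrightarrow> f x = m * x + c"
  shows "D = m"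
proof -
  have "(f has_real_derivative D) (at x within {a..b})"
    using assms(1,2) by (rule has_field_derivative_subset)
  moreover have "(f has_real_derivative m) (at x within {a..b})"
    by (rule affine_has_derivative_within) (use assms in auto)
  moreover have "at x within {a..b} \<noteq> bot"
    using assms(3,4) by (simp add: trivial_limit_within islimpt_Icc)
  ultimately show ?thesis using has_field_derivative_unique by blast
qed

text \<open>A partition with the least number of pieces has no removable points, since two adjacent
  affine pieces meeting at a point of differentiability have the same slope.\<close>

lemma piecewise_linear_on_minimal:
  assumes "piecewise_linear_on a b f"
  obtains n t where "t 0 = a" "t n = b" "\<forall>i<n. t i < t (Suc i)"
    "\<forall>i<n. \<exists>m c. \<forall>x\<in>{t i..t (Suc i)}. f x = m * x + c"
    "\<forall>i\<in>{0<..<n}. \<not> f differentiable (at (t i) within {a..b})"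
proof -
  define P where "P n t \<longleftrightarrow> t 0 = a \<and> t n = b \<and> (\<forall>i<n. t i < t (Suc i)) \<and>
    (\<forall>i<n. \<exists>m c. \<forall>x\<in>{t i..t (Suc i)}. f x = m * x + c)" for n :: nat and t :: "nat \<Rightarrow> real"
  define n where "n = (LEAST n. \<exists>t. P n t)"
  have "\<exists>n t. P n t" using assms unfolding piecewise_linear_on_def P_def by blast
  then have "\<exists>t. P n t" unfolding n_def by (rule LeastI_ex)
  then obtain t where "P n t" by blast
  then have t: "t 0 = a" "t n = b" "\<And>i. i < n \<Longrightarrow> t i < t (Suc i)"
    and aff: "\<And>i. i < n \<Longrightarrow> \<exists>m c. \<forall>x\<in>{t i..t (Suc i)}. f x = m * x + c"
    unfolding P_def by blast+
  note mono = partition_mono[of n t, OF t(3)]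
  have "\<not> f differentiable (at (t i) within {a..b})" if i: "0 < i" "i < n" for i
  proof
    assume "f differentiable (at (t i) within {a..b})"
    then obtain D where D: "(f has_real_derivative D) (at (t i) within {a..b})"
      using real_differentiable_def by blast
    obtain j where j: "i = Suc j" using i(1) by (cases i) auto
    obtain m c where mc: "\<And>x. x \<in> {t j..t i} \<Longrightarrow> f x = m * x + c"
      using aff[of j] i j by auto
    obtain m' c' where mc': "\<And>x. x \<in> {t i..t (Suc i)} \<Longrightarrow> f x = m' * x + c'"
      using aff[of i] i by auto
    have lt: "t j < t i" "t i < t (Suc i)" using t(3)[of j] t(3)[of i] i j by auto
    have "{t j..t i} \<subseteq> {a..b}" "{t i..t (Suc i)} \<subseteq> {a..b}"
      using mono[of 0 j] mono[of i n] mono[of 0 i] mono[of "Suc i" n] i j t(1,2) by auto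
    then have "D = m" "D = m'"
      using lt
      by (intro derivative_within_affine[OF D, of "t j" "t i" m c] mc
            derivative_within_affine[OF D, of "t i" "t (Suc i)" m' c'] mc'; simp)+
    then have m: "m' = m" by simp
    then have c: "c' = c" using mc[of "t i"] mc'[of "t i"] lt by auto
    \<comment> \<open>The i-th point is deleted and later indices drop by one; piece
      \<open>j\<close> of \<open>t'\<close> is the union of pieces \<open>j\<close> and
      \<open>i\<close> of \<open>t\<close>, which now carry the same affine formula.\<close>
    define t' where "t' l = (if l < i then t l else t (Suc l))" for l
    have "P (n - 1) t'"
      unfolding P_def
    proof (intro conjI allI impI)
      show "t' 0 = a" using i t by (simp add: t'_def)
      have "\<not> n - 1 < i" "Suc (n - 1) = n" using i by auto
      then show "t' (n - 1) = b" using t(2) by (simp add: t'_def)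
      fix l assume l: "l < n - 1"
      show "t' l < t' (Suc l)"
        using t(3)[of l] t(3)[of "Suc l"] l less_diff_conv[of l n 1] by (auto simp: t'_def)
      consider "Suc l < i" | "l = j" | "i \<le> l" using j by linarith
      then show "\<exists>m c. \<forall>x\<in>{t' l..t' (Suc l)}. f x = m * x + c"
      proof cases
        case 1
        then show ?thesis using aff[of l] l by (simp add: t'_def)
      next
        case 2
        have "f x = m * x + c" if "x \<in> {t j..t (Suc i)}" for x
          using that mc[of x] mc'[of x] m c by (cases "x \<le> t i") auto
        then show ?thesis using 2 j by (auto simp: t'_def)
      next
        case 3
        then show ?thesis using aff[of "Suc l"] l by (simp add: t'_def)
      qed
    qed
    then have "n \<le> n - 1" unfolding n_def by (intro Least_le) blast
    then show False using i by simp
  qed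
  with t aff show ?thesis by (intro that[of t n]) auto
qed

text \<open>Membership in F constrains only points of non-differentiability and derivatives. In a
  minimal partition every interior point is of the first kind, hence dyadic, and each slope is the
  derivative at some point inside its piece.\<close>

lemma thompson_F_dyadic_pl:
  assumes f: "f \<in> thompson_F"
  shows "\<exists>S. dyadic_pl S f"
proof -
  have pl: "piecewise_linear_on 0 1 f"
    and N: "{x\<in>{0..1}. \<not> f differentiable (at x within {0..1})} \<subseteq> dyadic_rationals"
    and der: "\<And>x. x \<in> {0..1} \<Longrightarrow> f differentiable (at x within {0..1}) \<Longrightarrow>
        \<exists>k::int. (f has_real_derivative 2 powi k) (at x within {0..1})"
    using f unfolding thompson_F_def by auto
  obtain n t where t: "t 0 = 0" "t n = 1" "\<forall>i<n. t i < t (Suc i)"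
    and aff: "\<forall>i<n. \<exists>m c. \<forall>x\<in>{t i..t (Suc i)}. f x = m * x + c"
    and nd: "\<forall>i\<in>{0<..<n}. \<not> f differentiable (at (t i) within {0..1})"
    by (rule piecewise_linear_on_minimal[OF pl])
  have mono: "t i \<le> t j" if "i \<le> j" "j \<le> n" for i j
    using partition_mono[of n t i j] t(3) that by blast
  have range: "t i \<in> {0..1}" if "i \<le> n" for i
    using mono[of 0 i] mono[of i n] that t by auto
  have "t i \<in> dyadic_rationals" if "i \<le> n" for i
  proof -
    consider "i = 0" | "i = n" | "0 < i" "i < n" using \<open>i \<le> n\<close> by linarith
    then show ?thesis
    proof cases
      case 3
      then show ?thesis using nd range[of i] N by auto
    qed (use t in auto)
  qed
  moreover have "\<exists>(k::int) c. \<forall>x\<in>{a..b}. f x = 2 powi k * x + c"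
    if ab: "0 \<le> a" "a < b" "b \<le> 1" and gap: "{a<..<b} \<inter> t ` {..n} = {}" for a b
  proof -
    define x where "x = (a + b) / 2"
    have x: "a < x" "x < b" using ab unfolding x_def by auto
    \<comment> \<open>The first partition point at or beyond the midpoint is the right end of the
      piece containing it.\<close>
    define j where "j = (LEAST j. x \<le> t j)"
    have xn: "x \<le> t n" using x ab t by simp
    have j: "x \<le> t j" "j \<le> n"
      unfolding j_def using xn by (rule LeastI, intro Least_le xn)
    obtain i where i: "j = Suc i" using j x ab t(1) by (cases j) auto
    have "\<not> x \<le> t i" using i not_less_Least[of i "\<lambda>j. x \<le> t j"] by (simp add: j_def)
    moreover have "t l \<notin> {a<..<b}" if "l \<le> n" for l using gap that by blast
    \<comment> \<open>No end of that piece lies inside the gap, so the piece covers all of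
      \<open>{a..b}\<close>.\<close>
    ultimately have "t i \<le> a" "b \<le> t j"
      using j i x by (meson Suc_leD greaterThanLessThan_iff less_le_trans not_le less_trans)+
    obtain m c where mc: "\<And>x. x \<in> {t i..t j} \<Longrightarrow> f x = m * x + c"
      using aff i j by (meson Suc_le_eq)
    have xi: "t i < x" "x < t j" using \<open>t i \<le> a\<close> \<open>b \<le> t j\<close> x by auto
    have "(f has_real_derivative m) (at x within {t i..t j})"
      by (rule affine_has_derivative_within[OF mc]) (use xi in auto)
    then have "(f has_real_derivative m) (at x within {0..1})"
      using xi by (simp add: at_within_Icc_at has_field_derivative_at_within)
    moreover from this obtain k :: int where "(f has_real_derivative 2 powi k) (at x within {0..1})"
      using der[of x] x ab real_differentiable_def by fastforce
    ultimately have "m = 2 powi k"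
      using derivative_within_affine[OF _ _ _ _ mc, of "2 powi k" x "{0..1}"]
        range[of i] range[of j] i j xi by auto
    then show ?thesis
      using mc \<open>t i \<le> a\<close> \<open>b \<le> t j\<close> by (intro exI[of _ k] exI[of _ c]) auto
  qed
  ultimately have "dyadic_pl (t ` {..n}) f"
    unfolding dyadic_pl_def by auto
  then show ?thesis by blast
qed

section \<open>The orbit relation of Thompson's group\<close>

lemma thompson_FE:
  assumes "f \<in> thompson_F"
  obtains g S where "f \<in> extensional {0..1}" "homeomorphism {0..1} {0..1} f g" "dyadic_pl S f"
  using assms thompson_F_dyadic_pl[OF assms] unfolding thompson_F_def by blast

text \<open>A continuous injection on an interval is strictly monotone, and the positive slope of f
  immediately to the right of a decides the direction.\<close>

lemma dyadic_pl_strict_mono: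
  assumes hom: "homeomorphism {0..1} {0..1} f g" and pl: "dyadic_pl S f"
    and ab: "0 \<le> a" "a < b" "b \<le> 1"
  shows "f a < f b"
proof -
  have fin: "finite S" using pl unfolding dyadic_pl_def by blast
  \<comment> \<open>The nearest point of \<open>S\<close> after a, capped by b; the midpoint of a
    and \<open>m\<close> is below b and no point of \<open>S\<close> precedes it after a.\<close>
  define m where "m = Min (insert b {s \<in> S. a < s})"
  have "m \<in> insert b {s \<in> S. a < s}"
    unfolding m_def using fin by (intro Min_in) auto
  then have m: "a < m" using ab by auto
  have m_le: "m \<le> s" if "s = b \<or> s \<in> S \<and> a < s" for s
    unfolding m_def using fin that by (intro Min_le) auto
  define d where "d = (a + m) / 2"
  have d: "a < d" "d < m" "d < b" using m m_le[of b] unfolding d_def by auto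
  have gap: "{a<..<d} \<inter> S = {}" using m_le d by (force simp: disjoint_iff)
  have "d \<le> 1" using d ab by simp
  obtain k :: int and c where "\<And>x. x \<in> {a..d} \<Longrightarrow> f x = 2 powi k * x + c"
    using dyadic_pl_affine[OF pl ab(1) d(1) \<open>d \<le> 1\<close> gap] by blast
  then have "f a < f d" using d by simp
  have cont: "continuous_on {a..b} f"
    using hom ab by (auto simp: homeomorphism_def intro: continuous_on_subset)
  have "inj_on f {0..1}" using hom by (auto simp: homeomorphism_def intro: inj_on_inverseI)
  then have inj: "inj_on f {a..b}" by (rule inj_on_subset) (use ab in auto)
  from continuous_inj_imp_mono[OF d(1,3) cont inj] \<open>f a < f d\<close> show ?thesis by auto
qed

text \<open>If the preimage of 0 were positive, monotonicity would make \<open>f 0\<close> negative;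
  the argument at 1 is dual.\<close>

lemma dyadic_pl_endpoints:
  assumes hom: "homeomorphism {0..1} {0..1} f g" and pl: "dyadic_pl S f"
  shows "f 0 = 0" "f 1 = 1"
proof -
  have g: "g 0 \<in> {0..1}" "g 1 \<in> {0..1}" "f (g 0) = 0" "f (g 1) = 1" "f 0 \<in> {0..1}" "f 1 \<in> {0..1}"
    using hom by (auto simp: homeomorphism_def)
  show "f 0 = 0" using dyadic_pl_strict_mono[OF hom pl, of 0 "g 0"] g by force
  show "f 1 = 1" using dyadic_pl_strict_mono[OF hom pl, of "g 1" 1] g by force
qed

text \<open>Induction on the number of breakpoints left of x. The piece ending at x starts at a
  dyadic point p whose image is dyadic by induction, or by \<open>f 0 = 0\<close>, so its intercept
  \<open>f p - 2 powi k * p\<close> is dyadic.\<close>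

lemma dyadic_pl_dyadic_equiv:
  assumes hom: "homeomorphism {0..1} {0..1} f g" and pl: "dyadic_pl S f"
    and "x \<in> {0..1}"
  shows "dyadic_equiv x (f x)"
  using assms(3)
proof (induction "card {s \<in> S. s < x}" arbitrary: x rule: less_induct)
  case less
  have fin: "finite S" and S: "S \<subseteq> dyadic_rationals" using pl unfolding dyadic_pl_def by auto
  show ?case
  proof (cases "x = 0")
    case True
    then show ?thesis using dyadic_pl_endpoints[OF hom pl] by simp
  next
    case False
    \<comment> \<open>Including 0 makes the maximum exist: it is the last breakpoint in the open
      interval from 0 to x, or 0 itself.\<close>
    define T where "T = insert 0 {s \<in> S. 0 < s \<and> s < x}"
    define p where "p = Max T"
    have finT: "finite T" using fin unfolding T_def by simp
    have "p \<in> T" unfolding p_def using finT by (intro Max_in) (auto simp: T_def)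
    then have p: "0 \<le> p" "p < x" "p \<in> dyadic_rationals"
      using False less.prems S unfolding T_def by auto
    have p_ge: "s \<le> p" if "s \<in> T" for s
      unfolding p_def using finT that by simp
    have "s \<notin> S" if "p < s" "s < x" for s
      using p_ge[of s] p that unfolding T_def by auto
    then have gap: "{p<..<x} \<inter> S = {}" by auto
    have "x \<le> 1" using less.prems by simp
    obtain k :: int and c where kc: "\<And>y. y \<in> {p..x} \<Longrightarrow> f y = 2 powi k * y + c"
      using dyadic_pl_affine[OF pl p(1,2) \<open>x \<le> 1\<close> gap] by blast
    have "dyadic_equiv p (f p)"
    proof (cases "p = 0")
      case True
      then show ?thesis using dyadic_pl_endpoints[OF hom pl] by simp
    next
      case False
      then have "p \<in> S" using \<open>p \<in> T\<close> unfolding T_def by auto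
      then have "{s \<in> S. s < p} \<subset> {s \<in> S. s < x}" using p by auto
      then have "card {s \<in> S. s < p} < card {s \<in> S. s < x}"
        using fin by (intro psubset_card_mono) auto
      then show ?thesis using less p by auto
    qed
    then have "f p \<in> dyadic_rationals" using p dyadic_equiv_dyadic by blast
    moreover have "c = f p - 2 powi k * p" using kc[of p] p by simp
    ultimately have "c \<in> dyadic_rationals"
      using p by (simp add: dyadic_rationals_diff dyadic_rationals_mult)
    then show ?thesis using kc[of x] p by (intro dyadic_equivI) auto
  qed
qed

lemma thompson_F_dyadic_equiv:
  assumes "f \<in> thompson_F" "x \<in> {0..1}"
  shows "dyadic_equiv x (f x)"
  using assms dyadic_pl_dyadic_equiv by (blast elim: thompson_FE)

section \<open>Closure of F under composition and inversion\<close>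

lemma thompson_F_comp:
  assumes f: "f \<in> thompson_F" and h: "h \<in> thompson_F"
  shows "restrict (f \<circ> h) {0..1} \<in> thompson_F"
proof -
  obtain f' S where f': "homeomorphism {0..1} {0..1} f f'" and S: "dyadic_pl S f"
    using f by (rule thompson_FE)
  obtain h' T where h': "homeomorphism {0..1} {0..1} h h'" and T: "dyadic_pl T h"
    using h by (rule thompson_FE)
  have "homeomorphism {0..1} {0..1} (f \<circ> h) (h' \<circ> f')"
    using h' f' by (rule homeomorphism_compose)
  then have hom: "homeomorphism {0..1} {0..1} (restrict (f \<circ> h) {0..1}) (h' \<circ> f')"
    by (rule homeomorphism_cong) auto
  \<comment> \<open>The composite can break only where h breaks or where h reaches a breakpoint of
    f.\<close>
  define U where "U = T \<union> {x \<in> {0..1}. h x \<in> S}"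
  have "dyadic_pl U (restrict (f \<circ> h) {0..1})"
    unfolding dyadic_pl_def
  proof (intro conjI allI impI)
    have "{x \<in> {0..1}. h x \<in> S} \<subseteq> h' ` S"
      using h' by (force simp: homeomorphism_def)
    then show "finite U"
      using S T finite_subset unfolding U_def dyadic_pl_def by blast
    show "U \<subseteq> dyadic_rationals"
    proof
      fix x assume "x \<in> U"
      then consider "x \<in> T" | "x \<in> {0..1}" "h x \<in> S" unfolding U_def by blast
      then show "x \<in> dyadic_rationals"
      proof cases
        case 1
        then show ?thesis using T unfolding dyadic_pl_def by blast
      next
        case 2
        then have "h x \<in> dyadic_rationals" using S unfolding dyadic_pl_def by blast
        then show ?thesis
          using thompson_F_dyadic_equiv[OF h 2(1)] dyadic_equiv_sym dyadic_equiv_dyadic by blast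
      qed
    qed
    fix a b :: real assume ab: "0 \<le> a" "a < b" "b \<le> 1" and gap: "{a<..<b} \<inter> U = {}"
    obtain k :: int and c where kc: "\<And>x. x \<in> {a..b} \<Longrightarrow> h x = 2 powi k * x + c"
      using dyadic_pl_affine[OF T ab] gap unfolding U_def by blast
    have range: "h a \<in> {0..1}" "h b \<in> {0..1}" using h' ab by (auto simp: homeomorphism_def)
    \<comment> \<open>Since h increases, a breakpoint of f between \<open>h a\<close> and
      \<open>h b\<close> would pull back to a point of \<open>U\<close> inside the gap.\<close>
    have pre: "h' y \<in> {a<..<b} \<and> h (h' y) = y" if y: "y \<in> {h a<..<h b}" for y
    proof -
      have y01: "y \<in> {0..1}" using y range by auto
      then have hy: "h' y \<in> {0..1}" "h (h' y) = y" using h' by (auto simp: homeomorphism_def)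
      have "a < h' y"
        using dyadic_pl_strict_mono[OF h' T, of "h' y" a] hy y ab by (cases "h' y" a rule: linorder_cases) auto
      moreover have "h' y < b"
        using dyadic_pl_strict_mono[OF h' T, of b "h' y"] hy y ab by (cases "h' y" b rule: linorder_cases) auto
      ultimately show ?thesis using hy by simp
    qed
    have gap': "{h a<..<h b} \<inter> S = {}"
    proof (rule ccontr)
      assume "{h a<..<h b} \<inter> S \<noteq> {}"
      then obtain y where y: "y \<in> {h a<..<h b}" "y \<in> S" by blast
      then have "h' y \<in> U" using pre[OF y(1)] ab unfolding U_def by auto
      then show False using pre[OF y(1)] gap by blast
    qed
    have bounds: "0 \<le> h a" "h a < h b" "h b \<le> 1"
      using range dyadic_pl_strict_mono[OF h' T ab] by auto
    obtain l :: int and d where ld: "\<And>x. x \<in> {h a..h b} \<Longrightarrow> f x = 2 powi l * x + d"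
      using dyadic_pl_affine[OF S bounds gap'] by blast
    have "restrict (f \<circ> h) {0..1} x = 2 powi (l + k) * x + (2 powi l * c + d)" if x: "x \<in> {a..b}" for x
    proof -
      have "h x \<in> {h a..h b}" using kc[of x] kc[of a] kc[of b] x by auto
      then have "f (h x) = 2 powi l * (2 powi k * x + c) + d" using ld kc[OF x] by simp
      then show ?thesis using x ab by (simp add: power_int_add algebra_simps)
    qed
    then show "\<exists>(k::int) c. \<forall>x\<in>{a..b}. restrict (f \<circ> h) {0..1} x = 2 powi k * x + c" by blast
  qed
  with hom show ?thesis by (intro dyadic_pl_in_thompson_F) auto
qed

lemma thompson_F_inverse:
  assumes f: "f \<in> thompson_F"
  obtains g where "g \<in> thompson_F" "\<And>x. x \<in> {0..1} \<Longrightarrow> g (f x) = x"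
proof -
  obtain f' S where f': "homeomorphism {0..1} {0..1} f f'" and S: "dyadic_pl S f"
    using f by (rule thompson_FE)
  define g where "g = restrict f' {0..1}"
  have hom: "homeomorphism {0..1} {0..1} g f"
    using homeomorphism_symD[OF f'] unfolding g_def by (rule homeomorphism_cong) auto
  have g: "g y \<in> {0..1}" "f (g y) = y" if "y \<in> {0..1}" for y
    using hom that by (auto simp: homeomorphism_def)
  have gf: "g (f x) = x" "f x \<in> {0..1}" if "x \<in> {0..1}" for x
    using hom that by (auto simp: homeomorphism_def)
  have mono: "g x < g y" if "0 \<le> x" "x < y" "y \<le> 1" for x y
    using dyadic_pl_strict_mono[OF f' S, of "g y" "g x"] g[of x] g[of y] that
    by (cases "g x" "g y" rule: linorder_cases) auto
  \<comment> \<open>The inverse breaks only at images of breakpoints, and these are dyadic because f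
    respects \<open>dyadic_equiv\<close>; on a piece it is the inverse affine map, of slope
    2^(-k).\<close>
  have "dyadic_pl (f ` (S \<inter> {0..1})) g"
    unfolding dyadic_pl_def
  proof (intro conjI allI impI)
    show "finite (f ` (S \<inter> {0..1}))" using S unfolding dyadic_pl_def by blast
    show "f ` (S \<inter> {0..1}) \<subseteq> dyadic_rationals"
      using thompson_F_dyadic_equiv[OF f] dyadic_equiv_dyadic S unfolding dyadic_pl_def by blast
    fix a b :: real assume ab: "0 \<le> a" "a < b" "b \<le> 1" and gap: "{a<..<b} \<inter> f ` (S \<inter> {0..1}) = {}"
    have range: "g a \<in> {0..1}" "g b \<in> {0..1}" using g ab by auto
    have gap': "{g a<..<g b} \<inter> S = {}"
    proof (rule ccontr)
      assume "{g a<..<g b} \<inter> S \<noteq> {}"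
      then obtain s where s: "g a < s" "s < g b" "s \<in> S" by auto
      then have "f (g a) < f s" "f s < f (g b)"
        using dyadic_pl_strict_mono[OF f' S] range by auto
      then have "f s \<in> {a<..<b}" using g[of a] g[of b] ab by auto
      then show False using gap s range by auto
    qed
    have bounds: "0 \<le> g a" "g a < g b" "g b \<le> 1"
      using range mono[OF ab] by auto
    obtain k :: int and c where kc: "\<And>x. x \<in> {g a..g b} \<Longrightarrow> f x = 2 powi k * x + c"
      using dyadic_pl_affine[OF S bounds gap'] by blast
    have "g y = 2 powi (-k) * y + - (2 powi (-k) * c)" if y: "y \<in> {a..b}" for y
    proof -
      have "g y \<in> {g a..g b}"
        using mono[of a y] mono[of y b] y ab by (cases "y = a"; cases "y = b") auto
      then have "y = 2 powi k * g y + c" using kc g[of y] y ab by auto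
      then have "2 powi (-k) * y = g y + 2 powi (-k) * c"
        by (simp add: power_int_minus field_simps)
      then show ?thesis by simp
    qed
    then show "\<exists>(k::int) c. \<forall>x\<in>{a..b}. g x = 2 powi k * x + c" by blast
  qed
  with hom have "g \<in> thompson_F" by (intro dyadic_pl_in_thompson_F) (auto simp: g_def)
  with gf that show ?thesis by blast
qed

lemma thompson_F_range:
  assumes "f \<in> thompson_F" "x \<in> {0..1}"
  shows "f x \<in> {0..1}"
  using assms unfolding thompson_F_def homeomorphism_def by blast

lemma thompson_F_id: "restrict (\<lambda>x. x) {0..1} \<in> thompson_F"
proof (rule dyadic_pl_in_thompson_F)
  show "homeomorphism {0..1} {0..1} (restrict (\<lambda>x. x) {0..1::real}) id"
    by (rule homeomorphism_cong[OF homeomorphism_ident]) auto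
  show "dyadic_pl {} (restrict (\<lambda>x. x) {0..1})"
    unfolding dyadic_pl_def by (auto intro!: exI[of _ "0::int"] exI[of _ "0::real"])
qed auto

section \<open>The orbit relation as an equivalence relation\<close>

lemma thompson_orbit_relI:
  "f \<in> thompson_F \<Longrightarrow> x \<in> {0..1} \<Longrightarrow> (x, f x) \<in> thompson_orbit_rel"
  using thompson_F_range unfolding thompson_orbit_rel_def by blast

lemma equiv_thompson_orbit_rel: "equiv {0..1} thompson_orbit_rel"
proof (rule equivI)
  show "thompson_orbit_rel \<subseteq> {0..1} \<times> {0..1}"
    unfolding thompson_orbit_rel_def by auto
  show "refl_on {0..1} thompson_orbit_rel"
    using thompson_orbit_relI[OF thompson_F_id] by (auto simp: refl_on_def)
  show "sym thompson_orbit_rel"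
  proof (rule symI)
    fix x y assume "(x, y) \<in> thompson_orbit_rel"
    then obtain f where f: "f \<in> thompson_F" "y = f x" "x \<in> {0..1}" "y \<in> {0..1}"
      unfolding thompson_orbit_rel_def by blast
    obtain g where "g \<in> thompson_F" "g y = x" using thompson_F_inverse[OF f(1)] f(2,3) by metis
    then show "(y, x) \<in> thompson_orbit_rel" using thompson_orbit_relI f(4) by blast
  qed
  show "trans thompson_orbit_rel"
  proof (rule transI)
    fix x y z assume "(x, y) \<in> thompson_orbit_rel" "(y, z) \<in> thompson_orbit_rel"
    then obtain f h where "h \<in> thompson_F" "f \<in> thompson_F" "y = h x" "z = f y" "x \<in> {0..1}"
      unfolding thompson_orbit_rel_def by blast
    then show "(x, z) \<in> thompson_orbit_rel"
      using thompson_orbit_relI[OF thompson_F_comp, of f h x] by auto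
  qed
qed

text \<open>Since f sends \<open>inv_into {0..1} f y\<close> to y, symmetry suffices, without
  identifying \<open>inv_into {0..1} f\<close> with an element of \<open>thompson_F\<close>.\<close>

lemma thompson_orbit_rel_inverse:
  assumes f: "f \<in> thompson_F" and y: "y \<in> {0..1}"
  shows "(y, inv_into {0..1} f y) \<in> thompson_orbit_rel"
proof -
  have "y \<in> f ` {0..1}" using f y unfolding thompson_F_def homeomorphism_def by blast
  then have "inv_into {0..1} f y \<in> {0..1}" "f (inv_into {0..1} f y) = y"
    by (rule inv_into_into, rule f_inv_into_f)
  then have "(inv_into {0..1} f y, y) \<in> thompson_orbit_rel"
    using thompson_orbit_relI[OF f] by metis
  then show ?thesis
    using equiv_thompson_orbit_rel unfolding equiv_def sym_def by blast
qed

theorem proposition3p1: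
  shows "thompson_orbit_rel =
    generated_equiv_rel
      {({0..1/2}, {0..3/4}, inv_into {0..1} thompson_A),
       ({1/2..3/4}, {1/2..7/8}, inv_into {0..1} thompson_B),
       ({3/4..1}, {1/2..1}, thompson_A)}"
proof
  \<comment> \<open>The orbit relation itself belongs to the family being intersected.\<close>
  show "generated_equiv_rel
      {({0..1/2}, {0..3/4}, inv_into {0..1} thompson_A),
       ({1/2..3/4}, {1/2..7/8}, inv_into {0..1} thompson_B),
       ({3/4..1}, {1/2..1}, thompson_A)} \<subseteq> thompson_orbit_rel"
    unfolding generated_equiv_rel_def
    by (rule Inter_lower)
       (auto intro: equiv_thompson_orbit_rel thompson_orbit_relI[OF thompson_A_in_F]
          thompson_orbit_rel_inverse[OF thompson_A_in_F] thompson_orbit_rel_inverse[OF thompson_B_in_F])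
  show "thompson_orbit_rel \<subseteq> generated_equiv_rel
      {({0..1/2}, {0..3/4}, inv_into {0..1} thompson_A),
       ({1/2..3/4}, {1/2..7/8}, inv_into {0..1} thompson_B),
       ({3/4..1}, {1/2..1}, thompson_A)}"
    unfolding generated_equiv_rel_def
  proof (intro subrelI InterI, elim CollectE conjE)
    fix x y and R :: "(real \<times> real) set"
    assume "(x, y) \<in> thompson_orbit_rel" and R: "equiv {0..1} R"
      and gen: "\<forall>(S, T, \<phi>)\<in>{({0..1/2}, {0..3/4}, inv_into {0..1} thompson_A),
       ({1/2..3/4}, {1/2..7/8}, inv_into {0..1} thompson_B),
       ({3/4..1}, {1/2..1}, thompson_A)}. \<forall>x\<in>S. (x, \<phi> x) \<in> R"
    then obtain f where f: "f \<in> thompson_F" and x: "x \<in> {0..1}" and y: "y = f x" "y \<in> {0..1}"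
      unfolding thompson_orbit_rel_def by blast
    have gen1: "\<forall>x\<in>{0..1/2}. (x, inv_into {0..1} thompson_A x) \<in> R"
      and gen2: "\<forall>x\<in>{1/2..3/4}. (x, inv_into {0..1} thompson_B x) \<in> R"
      and gen3: "\<forall>x\<in>{3/4..1}. (x, thompson_A x) \<in> R"
      using gen unfolding ball_simps prod.case by iprover+
    obtain g S where hom: "homeomorphism {0..1} {0..1} f g" and S: "dyadic_pl S f"
      using f by (rule thompson_FE)
    note ends = dyadic_pl_endpoints[OF hom S]
    show "(x, y) \<in> R"
    \<comment> \<open>The endpoints are fixed by f and need only reflexivity. Any other point stays
      in the open interval, where dyadic equivalence implies membership in \<open>R\<close>.\<close>
    proof (cases "x \<in> {0, 1}")
      case True
      then have "x = y" using y ends by auto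
      then show ?thesis using R x unfolding equiv_def refl_on_def by blast
    next
      case False
      then have x': "x \<in> {0<..<1}" using x by auto
      then have y': "y \<in> {0<..<1}"
        using dyadic_pl_strict_mono[OF hom S, of 0 x] dyadic_pl_strict_mono[OF hom S, of x 1] ends y
        by auto
      have "dyadic_equiv x y" using thompson_F_dyadic_equiv[OF f x] y by simp
      then show ?thesis
        by (rule dyadic_equiv_imp_R[OF R gen1 gen2 gen3 x' y'])
    qed
  qed
qed

end
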